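(* Let $n>1$ be an integer and let $a,b\in\mathbb Z_n$ be incomparable with respect to $\leq$. Let $d=\gcd(\gcd(a-1,b-1),n)$. Then the meet $a\wedge b$ (greatest lower bound of $\{a,b\}$) exists in $(\mathbb Z_n,\leq)$ if and only if the ideal $(n/d)$ of $\mathbb Z_n$ has a largest element with respect to $\leq$.
   Context: On $\mathbb Z_n$ define the partial order $\leq$ by: $a\leq b$ iff $a=b$ or $a\equiv ab\pmod n$. For $x\in\mathbb Z_n$, $(x)$ denotes the ideal of $\mathbb Z_n$ generated by $x$. Gcds are taken of integer representatives. *)

theory Defs
  imports "HOL-Number_Theory.Residues" "HOL-Algebra.Ideal" "HOL-Algebra.Order"
begin

definition zn_order :: "int \<Rightarrow> int gorder" where
  "zn_order n =
     \<lparr>carrier = carrier (residue_ring n),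
      eq = (=),
      le = (\<lambda>a b. a = b \<or> [a = a * b] (mod n))\<rparr>"

lemma partial_order_zn_order:
  "partial_order (zn_order n)"
proof
  fix x y
  assume xy: "x \<sqsubseteq>\<^bsub>zn_order n\<^esub> y" "y \<sqsubseteq>\<^bsub>zn_order n\<^esub> x"
    and c: "x \<in> carrier (zn_order n)" "y \<in> carrier (zn_order n)"
  have "[x = y] (mod n)"
    using xy by (auto simp: zn_order_def) (metis cong_sym cong_trans mult.commute)
  then show "x .=\<^bsub>zn_order n\<^esub> y"
    using c by (auto simp: zn_order_def residue_ring_def cong_def)
next
  fix x y z
  assume xy: "x \<sqsubseteq>\<^bsub>zn_order n\<^esub> y" and yz: "y \<sqsubseteq>\<^bsub>zn_order n\<^esub> z"
  show "x \<sqsubseteq>\<^bsub>zn_order n\<^esub> z"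
  proof (cases "x = y \<or> y = z")
    case True
    then show ?thesis using xy yz by auto
  next
    case False
    then have 1: "[x = x * y] (mod n)" and 2: "[y = y * z] (mod n)"
      using xy yz by (auto simp: zn_order_def)
    have "[x * y = x * (y * z)] (mod n)"
      using 2 by (rule cong_scalar_left)
    moreover have "[x * z = x * y * z] (mod n)"
      using 1 by (rule cong_scalar_right)
    ultimately have "[x = x * z] (mod n)"
      using 1 by (metis cong_sym cong_trans mult.assoc)
    then show ?thesis by (simp add: zn_order_def)
  qed
qed (auto simp: zn_order_def)

end

theory Submission
  imports Defs
begin

text \<open>
  For incomparable \<open>a\<close> and \<open>b\<close>, no lower bound of \<open>{a, b}\<close> is \<open>a\<close> or \<open>b\<close> itself, so the lower
  bounds are exactly the \<open>c\<close> with \<open>c (a - 1) \<equiv> c (b - 1) \<equiv> 0\<close>, that is \<open>n dvd c * d\<close>. These are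
  the multiples of \<open>n div d\<close>: the set of lower bounds equals the ideal \<open>(n div d)\<close>.
\<close>

text \<open>Reduction modulo n changes an integer by a multiple of n, hence of e, so divisibility by
  e survives it. The generator is reduced because e = n, the case d = 1 of the theorem, lies outside
  the carrier and stands for 0.\<close>

lemma Idl_residue_ring_singleton:
  fixes n e :: int
  assumes "n > 1" and "e dvd n"
  shows "Idl\<^bsub>residue_ring n\<^esub> {e mod n} = {c \<in> carrier (residue_ring n). e dvd c}"
proof -
  interpret residues n "residue_ring n"
    using assms(1) by unfold_locales auto
  have "e mod n \<in> carrier (residue_ring n)"
    using assms(1) by (simp add: residue_ring_def)
  then have "Idl\<^bsub>residue_ring n\<^esub> {e mod n} = PIdl\<^bsub>residue_ring n\<^esub> (e mod n)"
    by (rule cgenideal_eq_genideal[symmetric])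
  also have "\<dots> = {c \<in> carrier (residue_ring n). e dvd c}"
  proof (intro equalityI subsetI)
    fix c
    assume "c \<in> PIdl\<^bsub>residue_ring n\<^esub> (e mod n)"
    then obtain y where "c = y * (e mod n) mod n"
      by (auto simp: cgenideal_def residue_ring_def)
    then have "c = y * e mod n"
      by (simp add: mod_mult_right_eq)
    then show "c \<in> {c \<in> carrier (residue_ring n). e dvd c}"
      using assms by (simp add: residue_ring_def dvd_mod)
  next
    fix c
    assume "c \<in> {c \<in> carrier (residue_ring n). e dvd c}"
    then obtain k where k: "c = e * k" and c: "0 \<le> c" "c < n"
      by (auto simp: residue_ring_def)
    have "c = (k mod n) * (e mod n) mod n"
      using k c by (simp add: mod_mult_eq mult.commute)
    moreover have "k mod n \<in> carrier (residue_ring n)"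
      using assms(1) by (simp add: residue_ring_def)
    ultimately show "c \<in> PIdl\<^bsub>residue_ring n\<^esub> (e mod n)"
      by (auto simp: cgenideal_def residue_ring_def)
  qed
  finally show ?thesis .
qed

text \<open>Multiplying by the gcd clears the quotient; the factor c then distributes over the gcd,
  and its third argument n only adds the trivial condition n | c * n.\<close>

lemma dvd_mult_gcd_iff_div_dvd:
  fixes n c u v :: int
  assumes "n \<noteq> 0"
  shows "n div gcd (gcd u v) n dvd c \<longleftrightarrow> n dvd c * u \<and> n dvd c * v"
proof -
  let ?d = "gcd (gcd u v) n"
  have "?d dvd n" "?d \<noteq> 0"
    using assms by simp_all
  have dvd_gcd: "n dvd c * gcd x y \<longleftrightarrow> n dvd c * x \<and> n dvd c * y" for x y
  proof -
    \<comment> \<open>The absolute value is there because c may be negative, whereas a gcd never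
      is.\<close>
    have "\<bar>c * gcd x y\<bar> = gcd (c * x) (c * y)"
      by (simp add: abs_mult gcd_mult_distrib_int)
    then show ?thesis
      by (metis dvd_abs_iff gcd_greatest_iff)
  qed
  from \<open>?d dvd n\<close> \<open>?d \<noteq> 0\<close> have "n div ?d dvd c \<longleftrightarrow> n dvd c * ?d"
    by (metis dvd_div_mult_self dvd_mult_cancel_right)
  also have "\<dots> \<longleftrightarrow> n dvd c * u \<and> n dvd c * v"
    by (simp add: dvd_gcd)
  finally show ?thesis .
qed

lemma Lower_zn_order_incomparable:
  fixes n a b :: int
  assumes "n > 1"
    and "a \<in> carrier (residue_ring n)"
    and "b \<in> carrier (residue_ring n)"
    and "\<not> a \<sqsubseteq>\<^bsub>zn_order n\<^esub> b"
    and "\<not> b \<sqsubseteq>\<^bsub>zn_order n\<^esub> a"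
  shows "Lower (zn_order n) {a, b} =
    {c \<in> carrier (residue_ring n). n div gcd (gcd (a - 1) (b - 1)) n dvd c}"
proof -
  have le: "c \<sqsubseteq>\<^bsub>zn_order n\<^esub> x \<longleftrightarrow> c = x \<or> n dvd c * (x - 1)" for c x
    by (simp add: zn_order_def cong_iff_dvd_diff dvd_diff_commute[of n c] right_diff_distrib)
  have "c \<sqsubseteq>\<^bsub>zn_order n\<^esub> a \<and> c \<sqsubseteq>\<^bsub>zn_order n\<^esub> b \<longleftrightarrow>
      n div gcd (gcd (a - 1) (b - 1)) n dvd c" for c
    \<comment> \<open>If c = a, then c \<sqsubseteq> b would make a and b comparable, and
      symmetrically for c = b; only the divisibility disjuncts of \<open>le\<close> remain.\<close>
    using assms by (subst dvd_mult_gcd_iff_div_dvd) (auto simp: le)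
  then show ?thesis
    using assms(2,3) by (auto simp: Lower_def zn_order_def)
qed

theorem theorem3p3:
  fixes n a b d :: int
  assumes "n > 1"
    and "a \<in> carrier (residue_ring n)"
    and "b \<in> carrier (residue_ring n)"
    and "\<not> a \<sqsubseteq>\<^bsub>zn_order n\<^esub> b"
    and "\<not> b \<sqsubseteq>\<^bsub>zn_order n\<^esub> a"
    and "d = gcd (gcd (a - 1) (b - 1)) n"
  shows "(\<exists>m. is_glb (zn_order n) m {a, b}) \<longleftrightarrow>
         (\<exists>g. greatest (zn_order n) g (Idl\<^bsub>residue_ring n\<^esub> {(n div d) mod n}))"
proof -
  have "n div d dvd n"
    using assms(6) by (metis dvd_div_mult_self dvd_triv_left gcd_dvd2)
  then have "Lower (zn_order n) {a, b} = Idl\<^bsub>residue_ring n\<^esub> {(n div d) mod n}"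
    using assms by (simp add: Lower_zn_order_incomparable Idl_residue_ring_singleton)
  \<comment> \<open>\<open>is_glb\<close> means a greatest element of the set \<open>Lower\<close>,
    so equality of the two sets suffices.\<close>
  then show ?thesis
    by simp
qed

end
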